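(* Let $1<p<\infty$ and let $X=(X,d,\mu)$ be an unbounded metric measure space such that $\mu$ is globally doubling and supports a global $p$-Poincaré inequality with dilation constant $\lambda$. Let $x_0\in X$. Suppose that at least one of the following holds: (i) there are constants $\sigma>1$ and $C>0$ such that $$\frac{\mu(B(x,r))}{\mu(B(x,R))}\le C\Bigl(\frac rR\Bigr)^\sigma\quad\text{whenever }x\in X\text{ and }0<r\le R<\infty,$$ and $X$ supports a global $\sigma$-Poincaré inequality; (ii) $X$ is annularly quasiconvex around $x_0$. Then $X$ is sequentially annularly chainable around $x_0$, and every sequence $r_j\nearrow\infty$ may be used as the sequence of radii in the definition of sequential annular chainability.
   Context: Throughout, $X=(X,d,\mu)$ is a metric space with a positive complete Borel measure $\mu$ such that $0<\mu(B)<\infty$ for all balls $B\subset X$. $X$ need not be complete. Balls are open and come with a prescribed centre and radius $r_B$; $\lambda B$ is the concentric ball with radius $\lambda r_B$. Write $B_r=B(x_0,r)$. Upper gradients and Poincaré. Curves are nonconstant, compact and rectifiable, parameterized by arc length $ds$. Let $1\le q<\infty$. A property holds for $q$-almost every curve if for the family $\Gamma$ of curves for which it fails there is a Borel function $0\le\rho\in L^q(X)$ with $\int_\gamma\rho\,ds=\infty$ for all $\gamma\in\Gamma$. A measurable $g:X\to[0,\infty]$ is a $q$-weak upper gradient of $u:X\to[-\infty,\infty]$ if for $q$-almost every curve $\gamma:[0,l_\gamma]\to X$, $|u(\gamma(0))-u(\gamma(l_\gamma))|\le\int_\gamma g\,ds$ (left-hand side $\infty$ if a term is $\pm\infty$).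 $X$ supports a global $q$-Poincaré inequality with dilation constant $\lambda\ge1$ if there is $C>0$ such that for all balls $B$, all integrable $u$ on $\lambda B$ and all $q$-weak upper gradients $g$ of $u$, $\frac1{\mu(B)}\int_B|u-u_B|\,d\mu\le Cr_B\bigl(\frac1{\mu(\lambda B)}\int_{\lambda B}g^q\,d\mu\bigr)^{1/q}$, where $u_B=\frac1{\mu(B)}\int_Bu\,d\mu$. $\mu$ is globally doubling if there is $C>0$ with $\mu(2B)\le C\mu(B)$ for all balls $B$. Annular quasiconvexity. $X$ is annularly quasiconvex around $x_0$ if there exists $\Lambda\ge2$ such that for every $r>0$, each pair of points $x,y\in B_{2r}\setminus B_r$ can be connected within $B_{\Lambda r}\setminus B_{r/\Lambda}$ by a curve of length at most $\Lambda d(x,y)$. Chainability. $X$ is sequentially annularly chainable around $x_0$ if there are a constant $\Lambda>1$ and a sequence of radii $r_j\nearrow\infty$ such that for every $j$ and $x,y\in\partial B_{r_j}$ there is a chain of points $x=x_1,\ldots,x_m=y$ in $B_{\Lambda r_j}\setminus B_{r_j/\Lambda}$ satisfying $d(x_k,x_{k+1})<r_j/(8\lambda\Lambda)$ for $k=1,\ldots,m-1$, where $\lambda$ is the dilation constant of the global $p$-Poincaré inequality. *)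

theory Defs
  imports "HOL-Analysis.Analysis"
begin

(* A measure on a sigma-algebra that contains the Borel sets but may be larger
   (for instance the completion of a Borel measure).  *)
locale metric_measure_space = complete_measure M
  for M :: "'a::metric_space measure" +
  assumes space_eq: "space M = UNIV"
    and borel_sets: "sets borel \<subseteq> sets M"
    and ball_pos: "\<And>x r. 0 < r \<Longrightarrow> 0 < emeasure M (ball x r)"
    and ball_finite: "\<And>x r. 0 < r \<Longrightarrow> emeasure M (ball x r) < \<infinity>"

definition globally_doubling :: "'a::metric_space measure \<Rightarrow> bool" where
  "globally_doubling M \<longleftrightarrow>
     (\<exists>C>0. \<forall>x r. 0 < r \<longrightarrow> measure M (ball x (2 * r)) \<le> C * measure M (ball x r))"

(* Supremum of the lengths of all inscribed polygonal chains. *)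
definition curve_length :: "(real \<Rightarrow> 'a::metric_space) \<Rightarrow> real \<Rightarrow> real \<Rightarrow> ennreal" where
  "curve_length \<gamma> a b =
     (SUP ts \<in> {ts. sorted ts \<and> set ts \<subseteq> {a..b}}.
        \<Sum>i<length ts - 1. ennreal (dist (\<gamma> (ts ! i)) (\<gamma> (ts ! Suc i))))"

(* A nonconstant compact rectifiable curve, parameterized by arc length on [0,l];
   it is represented by the pair (\<gamma>, l), and \<gamma> is irrelevant off [0,l]. *)
definition arc_length_curve :: "(real \<Rightarrow> 'a::metric_space) \<Rightarrow> real \<Rightarrow> bool" where
  "arc_length_curve \<gamma> l \<longleftrightarrow>
     0 < l \<and> continuous_on {0..l} \<gamma> \<and> (\<forall>t\<in>{0..l}. curve_length \<gamma> 0 t = ennreal t)"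

definition line_integral :: "(real \<Rightarrow> 'a) \<Rightarrow> real \<Rightarrow> ('a \<Rightarrow> ennreal) \<Rightarrow> ennreal" where
  "line_integral \<gamma> l g = (\<integral>\<^sup>+t\<in>{0..l}. g (\<gamma> t) \<partial>lebesgue)"

(* Only used with q > 0. *)
definition ennreal_powr :: "ennreal \<Rightarrow> real \<Rightarrow> ennreal" where
  "ennreal_powr a q = (if a = \<infinity> then \<infinity> else ennreal (enn2real a powr q))"

definition ae_curve ::
  "'a::metric_space measure \<Rightarrow> real \<Rightarrow> ((real \<Rightarrow> 'a) \<Rightarrow> real \<Rightarrow> bool) \<Rightarrow> bool" where
  "ae_curve M q P \<longleftrightarrow>
     (\<exists>\<rho> \<in> borel_measurable borel.
        (\<integral>\<^sup>+x. ennreal_powr (\<rho> x) q \<partial>M) < \<infinity> \<and>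
        (\<forall>\<gamma> l. arc_length_curve \<gamma> l \<and> \<not> P \<gamma> l \<longrightarrow> line_integral \<gamma> l \<rho> = \<infinity>))"

definition ereal_diff :: "ereal \<Rightarrow> ereal \<Rightarrow> ennreal" where
  "ereal_diff a b = (if \<bar>a\<bar> = \<infinity> \<or> \<bar>b\<bar> = \<infinity> then \<infinity> else e2ennreal \<bar>a - b\<bar>)"

(* The inequality includes that the line integral of g is defined, i.e. that g is measurable
   along the curve: nn_integral is a total function, so this has to be required explicitly. *)
definition weak_upper_gradient ::
  "'a::metric_space measure \<Rightarrow> real \<Rightarrow> ('a \<Rightarrow> ereal) \<Rightarrow> ('a \<Rightarrow> ennreal) \<Rightarrow> bool" where
  "weak_upper_gradient M q u g \<longleftrightarrow>
     g \<in> borel_measurable M \<and>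
     ae_curve M q (\<lambda>\<gamma> l. (\<lambda>t. g (\<gamma> t)) \<in> borel_measurable (lebesgue_on {0..l}) \<and>
                          ereal_diff (u (\<gamma> 0)) (u (\<gamma> l)) \<le> line_integral \<gamma> l g)"

definition ereal_integrable_on :: "'a measure \<Rightarrow> 'a set \<Rightarrow> ('a \<Rightarrow> ereal) \<Rightarrow> bool" where
  "ereal_integrable_on M A u \<longleftrightarrow>
     u \<in> borel_measurable (restrict_space M A) \<and> (\<integral>\<^sup>+x\<in>A. e2ennreal \<bar>u x\<bar> \<partial>M) < \<infinity>"

(* An integrable u is finite almost everywhere, so real_of_ereal does not change the mean. *)
definition mean :: "'a measure \<Rightarrow> 'a set \<Rightarrow> ('a \<Rightarrow> ereal) \<Rightarrow> real" where
  "mean M B u = (LINT x:B|M. real_of_ereal (u x)) / measure M B"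

definition supports_poincare :: "'a::metric_space measure \<Rightarrow> real \<Rightarrow> real \<Rightarrow> bool" where
  "supports_poincare M q dil \<longleftrightarrow>
     1 \<le> dil \<and>
     (\<exists>C>0. \<forall>x r u g.
        0 < r \<longrightarrow> ereal_integrable_on M (ball x (dil * r)) u \<longrightarrow> weak_upper_gradient M q u g \<longrightarrow>
        (\<integral>\<^sup>+y\<in>ball x r. ereal_diff (u y) (ereal (mean M (ball x r) u)) \<partial>M)
            / emeasure M (ball x r)
        \<le> ennreal (C * r) *
           ennreal_powr ((\<integral>\<^sup>+y\<in>ball x (dil * r). ennreal_powr (g y) q \<partial>M)
                          / emeasure M (ball x (dil * r))) (1 / q))"

(* Curves are nonconstant, so the condition concerns distinct points only. *)
definition annularly_quasiconvex :: "'a::metric_space \<Rightarrow> bool" where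
  "annularly_quasiconvex x0 \<longleftrightarrow>
     (\<exists>\<Lambda>\<ge>2. \<forall>r>0. \<forall>x \<in> ball x0 (2 * r) - ball x0 r. \<forall>y \<in> ball x0 (2 * r) - ball x0 r.
        x \<noteq> y \<longrightarrow>
        (\<exists>\<gamma> l. arc_length_curve \<gamma> l \<and> \<gamma> 0 = x \<and> \<gamma> l = y \<and>
               \<gamma> ` {0..l} \<subseteq> ball x0 (\<Lambda> * r) - ball x0 (r / \<Lambda>) \<and> l \<le> \<Lambda> * dist x y))"

definition radii_to_infinity :: "(nat \<Rightarrow> real) \<Rightarrow> bool" where
  "radii_to_infinity r \<longleftrightarrow> (\<forall>j. 0 < r j) \<and> incseq r \<and> filterlim r at_top sequentially"

definition annularly_chainable_along ::
  "real \<Rightarrow> 'a::metric_space \<Rightarrow> (nat \<Rightarrow> real) \<Rightarrow> bool" where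
  "annularly_chainable_along dil x0 r \<longleftrightarrow>
     (\<exists>\<Lambda>>1. \<forall>j. \<forall>x \<in> frontier (ball x0 (r j)). \<forall>y \<in> frontier (ball x0 (r j)).
        \<exists>xs. xs \<noteq> [] \<and> hd xs = x \<and> last xs = y \<and>
             set xs \<subseteq> ball x0 (\<Lambda> * r j) - ball x0 (r j / \<Lambda>) \<and>
             successively (\<lambda>a b. dist a b < r j / (8 * dil * \<Lambda>)) xs)"

definition sequentially_annularly_chainable :: "real \<Rightarrow> 'a::metric_space \<Rightarrow> bool" where
  "sequentially_annularly_chainable dil x0 \<longleftrightarrow>
     (\<exists>r. radii_to_infinity r \<and> annularly_chainable_along dil x0 r)"

end

theory Submission
  imports Defs
begin

text \<open>
  Both alternatives lead to more than chainability: there is a \<open>\<Lambda>\<close> such that any two points of a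
  sphere of radius \<open>r\<close> about \<open>x0\<close> are joined, for every \<open>\<epsilon> > 0\<close>, by a chain with steps shorter than
  \<open>\<epsilon>\<close> inside the annulus with radii \<open>r / \<Lambda>\<close> and \<open>\<Lambda> * r\<close>. All radii are treated alike, so every
  sequence of radii is admissible.

  Under annular quasiconvexity this is immediate, since a curve is a connected set and connected
  sets contain arbitrarily fine chains.

  Under the volume condition, the idea is that a point has vanishing \<open>\<sigma>\<close>-capacity, so that the removal
  of a small ball about \<open>x0\<close> cannot disconnect a space with a \<open>\<sigma>\<close>-Poincare inequality. Suppose
  that no chain leads from \<open>x\<close> to \<open>y\<close>, and let \<open>E\<close> be the set of points of the annulus that chains
  from \<open>x\<close> reach. Points of the annulus in and outside \<open>E\<close> have distance at least \<open>\<epsilon>\<close>. Multiply the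
  indicator of \<open>E\<close> by a cutoff function that vanishes outside the annulus. The product has the
  gradient of the cutoff as an upper gradient (\<open>weak_upper_gradient_restrict\<close>): a curve can change
  sides only through the zero set of the cutoff. If the cutoff descends towards \<open>x0\<close> in \<open>N\<close>
  layers of geometrically decreasing radii, each layer contributes a multiple of
  \<open>N powr (- \<sigma>)\<close> to the \<open>\<sigma>\<close>-energy (\<open>log_cutoff_energy_le\<close>), and the total \<open>N powr (1 - \<sigma>)\<close>
  tends to 0 because \<open>\<sigma> > 1\<close>.

  The oscillation of the product, on the other hand, is bounded from below uniformly in \<open>N\<close> and \<open>\<epsilon>\<close>.
  Near the sphere of radius \<open>r\<close> the gradient vanishes, so the Poincare inequality on balls of
  radius comparable to \<open>r\<close> about \<open>x\<close> and \<open>y\<close> makes the product constant there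
  (\<open>zero_gradient_imp_constant\<close>), with value 1 about \<open>x\<close> and 0 about \<open>y\<close>. By the doubling condition
  these balls fill a fixed proportion of the ball of radius \<open>2 * r\<close> about \<open>x0\<close>. The Poincare
  inequality on that ball fails once \<open>N\<close> is large.
\<close>

section \<open>Chains of points\<close>

abbreviation chain_connected :: "'a::metric_space set \<Rightarrow> real \<Rightarrow> 'a \<Rightarrow> 'a \<Rightarrow> bool" where
  "chain_connected S e \<equiv> (\<lambda>a b. a \<in> S \<and> b \<in> S \<and> dist a b < e)\<^sup>*\<^sup>*"

lemma chain_connected_sym:
  assumes "chain_connected S e x y"
  shows "chain_connected S e y x"
  using assms
proof induction
  case (step y z)
  then have "chain_connected S e z y" by (intro r_into_rtranclp) (simp add: dist_commute)
  then show ?case using step.IH by (rule rtranclp_trans)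
qed simp

lemma chain_connected_imp_chain:
  assumes "chain_connected S e x y" and "x \<in> S"
  shows "\<exists>xs. xs \<noteq> [] \<and> hd xs = x \<and> last xs = y \<and> set xs \<subseteq> S \<and>
              successively (\<lambda>a b. dist a b < e) xs"
  using assms(1)
proof induction
  case base
  show ?case by (rule exI[of _ "[x]"]) (use assms(2) in simp)
next
  case (step y z)
  then obtain xs where "xs \<noteq> []" "hd xs = x" "last xs = y" "set xs \<subseteq> S"
      "successively (\<lambda>a b. dist a b < e) xs"
    by blast
  with step.hyps(2) show ?case
    by (intro exI[of _ "xs @ [z]"]) (auto simp: successively_append_iff)
qed

text \<open>
  The points of \<open>T\<close> that a chain in \<open>S\<close> reaches from a given point form a relatively open set,
  and these sets partition \<open>T\<close>. This serves twice: it turns a curve in an annulus into a chain,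
  and it shows that a chain component is a union of components of the annulus.
\<close>
lemma connected_imp_chain_connected:
  assumes "connected T" "T \<subseteq> S" "0 < e" "x \<in> T" "y \<in> T"
  shows "chain_connected S e x y"
proof (rule connected_equivalence_relation[OF assms(1) assms(4,5)])
  show "\<exists>U. openin (top_of_set T) U \<and> a \<in> U \<and> (\<forall>b\<in>U. chain_connected S e a b)"
    if "a \<in> T" for a
  proof (intro exI[of _ "T \<inter> ball a e"] conjI ballI)
    show "chain_connected S e a b" if "b \<in> T \<inter> ball a e" for b
      using that \<open>a \<in> T\<close> assms(2) by (intro r_into_rtranclp) auto
  qed (use that assms(3) in auto)
next
  show "chain_connected S e b a" if "chain_connected S e a b" for a b
    using that by (rule chain_connected_sym)
  show "chain_connected S e a c" if "chain_connected S e a b" "chain_connected S e b c" for a b c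
    using that by (rule rtranclp_trans)
qed

section \<open>Line integrals along arc length curves\<close>

text \<open>
  Appending \<open>s\<close> and \<open>t\<close> to a polygonal chain inscribed in the part of the curve before \<open>s\<close>
  lengthens it by at least the chord from \<open>\<gamma> s\<close> to \<open>\<gamma> t\<close>, and the length of these two parts is
  prescribed by the parameterization.
\<close>
lemma arc_length_curve_dist_le:
  assumes "arc_length_curve \<gamma> l" "s \<in> {0..l}" "t \<in> {0..l}"
  shows "dist (\<gamma> s) (\<gamma> t) \<le> \<bar>s - t\<bar>"
proof -
  have ordered: "dist (\<gamma> s) (\<gamma> t) \<le> t - s" if st: "0 \<le> s" "s \<le> t" "t \<le> l" for s t
  proof -
    let ?poly = "\<lambda>ts. \<Sum>i<length ts - 1. ennreal (dist (\<gamma> (ts ! i)) (\<gamma> (ts ! Suc i)))"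
    let ?d = "ennreal (dist (\<gamma> s) (\<gamma> t))"
    have len: "curve_length \<gamma> 0 s = ennreal s" "curve_length \<gamma> 0 t = ennreal t"
      using assms(1) st by (auto simp: arc_length_curve_def)
    have ext: "?poly ts + ?d \<le> curve_length \<gamma> 0 t" if ts: "sorted ts" "set ts \<subseteq> {0..s}" for ts
    proof -
      let ?ts = "ts @ [s, t]"
      have "?poly ts + ?d \<le> ?poly ?ts"
      proof -
        have "?poly ?ts = (\<Sum>i<length ts. ennreal (dist (\<gamma> (?ts ! i)) (\<gamma> (?ts ! Suc i)))) + ?d"
          by (simp add: nth_append)
        moreover have "?poly ts = (\<Sum>i<length ts - 1. ennreal (dist (\<gamma> (?ts ! i)) (\<gamma> (?ts ! Suc i))))"
          by (intro sum.cong) (auto simp: nth_append)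
        moreover have "\<dots> \<le> (\<Sum>i<length ts. ennreal (dist (\<gamma> (?ts ! i)) (\<gamma> (?ts ! Suc i))))"
          by (intro sum_mono2) auto
        ultimately show ?thesis by (simp only: add_right_mono)
      qed
      also have "\<dots> \<le> curve_length \<gamma> 0 t"
        unfolding curve_length_def
      proof (rule SUP_upper)
        show "?ts \<in> {ts. sorted ts \<and> set ts \<subseteq> {0..t}}"
          using ts st by (auto simp: sorted_append)
      qed
      finally show ?thesis .
    qed
    have "curve_length \<gamma> 0 s + ?d \<le> curve_length \<gamma> 0 t"
    proof -
      have "curve_length \<gamma> 0 s + ?d = (SUP ts \<in> {ts. sorted ts \<and> set ts \<subseteq> {0..s}}. ?poly ts + ?d)"
        unfolding curve_length_def
        by (subst ennreal_SUP_add_left) (auto intro!: exI[of _ "[]"])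
      also have "\<dots> \<le> curve_length \<gamma> 0 t"
        by (rule SUP_least) (use ext in auto)
      finally show ?thesis .
    qed
    then have "ennreal (s + dist (\<gamma> s) (\<gamma> t)) \<le> ennreal t"
      using st by (simp add: len ennreal_plus)
    then show ?thesis using st by (subst (asm) ennreal_le_iff) auto
  qed
  show ?thesis
    using ordered[of s t] ordered[of t s] assms(2,3) by (cases "s \<le> t") (auto simp: dist_commute)
qed

text \<open>
  The interval starts at the last visit to the level \<open>\<alpha>\<close> and ends at the first visit to
  \<open>\<beta>\<close> after that.
\<close>
lemma crossing_interval:
  fixes f :: "real \<Rightarrow> real"
  assumes "continuous_on {s..t} f" "s \<le> t" "f s \<le> \<alpha>" "\<alpha> \<le> \<beta>" "\<beta> \<le> f t"
  obtains s' t' where "s \<le> s'" "s' \<le> t'" "t' \<le> t" "f s' = \<alpha>" "f t' = \<beta>" "f ` {s'..t'} \<subseteq> {\<alpha>..\<beta>}"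
proof -
  define L where "L = {s..t} \<inter> f -` {\<alpha>}"
  have "closed L" unfolding L_def by (intro continuous_closed_preimage assms) auto
  have "L \<noteq> {}"
    using IVT'[of f s \<alpha> t] assms by (auto simp: L_def)
  define s' where "s' = Sup L"
  have s': "s' \<in> L"
    unfolding s'_def using \<open>closed L\<close> \<open>L \<noteq> {}\<close> by (intro closed_contains_Sup) (auto simp: L_def)
  have s'_max: "f \<tau> \<noteq> \<alpha>" if "s' < \<tau>" "\<tau> \<le> t" for \<tau>
  proof
    assume "f \<tau> = \<alpha>"
    then have "\<tau> \<in> L" using that s' by (auto simp: L_def)
    then have "\<tau> \<le> s'" unfolding s'_def by (intro cSup_upper) (auto simp: L_def)
    with that show False by simp
  qed
  have above: "\<alpha> \<le> f \<tau>" if "s' \<le> \<tau>" "\<tau> \<le> t" for \<tau>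
  proof (rule ccontr)
    assume "\<not> \<alpha> \<le> f \<tau>"
    then have "\<exists>x\<ge>\<tau>. x \<le> t \<and> f x = \<alpha>"
      using that s' assms by (intro IVT') (auto simp: L_def intro: continuous_on_subset)
    then obtain x where "\<tau> \<le> x" "x \<le> t" "f x = \<alpha>" by blast
    with s'_max[of x] that s' \<open>\<not> \<alpha> \<le> f \<tau>\<close> show False by (cases "x = s'") (auto simp: L_def)
  qed
  define U where "U = {s'..t} \<inter> f -` {\<beta>}"
  have cont': "continuous_on {s'..t} f"
    using assms(1) s' by (auto simp: L_def intro: continuous_on_subset)
  have "closed U" unfolding U_def by (intro continuous_closed_preimage cont') auto
  have "U \<noteq> {}"
    using IVT'[of f s' \<beta> t] assms s' cont' by (auto simp: U_def L_def)
  define t' where "t' = Inf U"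
  have t': "t' \<in> U"
    unfolding t'_def using \<open>closed U\<close> \<open>U \<noteq> {}\<close> by (intro closed_contains_Inf) (auto simp: U_def)
  have t'_min: "f \<tau> \<noteq> \<beta>" if "s' \<le> \<tau>" "\<tau> < t'" for \<tau>
  proof
    assume "f \<tau> = \<beta>"
    then have "\<tau> \<in> U" using that t' by (auto simp: U_def)
    then have "t' \<le> \<tau>" unfolding t'_def by (intro cInf_lower) (auto simp: U_def)
    with that show False by simp
  qed
  have below: "f \<tau> \<le> \<beta>" if "s' \<le> \<tau>" "\<tau> \<le> t'" for \<tau>
  proof (rule ccontr)
    assume "\<not> f \<tau> \<le> \<beta>"
    then have "\<exists>x\<ge>s'. x \<le> \<tau> \<and> f x = \<beta>"
      using that s' t' assms cont' by (intro IVT') (auto simp: L_def U_def intro: continuous_on_subset)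
    then obtain x where "s' \<le> x" "x \<le> \<tau>" "f x = \<beta>" by blast
    with t'_min[of x] that t' \<open>\<not> f \<tau> \<le> \<beta>\<close> show False by (cases "x = t'") (auto simp: U_def)
  qed
  show ?thesis
    using s' t' above below by (intro that[of s' t']) (auto simp: L_def U_def)
qed

lemma arc_borel_measurable:
  assumes "arc_length_curve \<gamma> l"
  shows "\<gamma> \<in> borel_measurable (lebesgue_on {0..l})"
proof -
  have "\<gamma> \<in> borel_measurable (restrict_space borel {0..l})"
    using assms by (intro borel_measurable_continuous_on_restrict) (simp add: arc_length_curve_def)
  then show ?thesis
    by (auto simp: measurable_def space_restrict_space sets_restrict_space)
qed

lemma line_integral_eq:
  "line_integral \<gamma> l g = (\<integral>\<^sup>+t. g (\<gamma> t) \<partial>lebesgue_on {0..l})"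
  by (simp add: line_integral_def nn_integral_restrict_space)

lemma line_integral_sum:
  assumes "arc_length_curve \<gamma> l" "\<And>i. i \<in> I \<Longrightarrow> g i \<in> borel_measurable borel"
  shows "line_integral \<gamma> l (\<lambda>z. \<Sum>i\<in>I. g i z) = (\<Sum>i\<in>I. line_integral \<gamma> l (g i))"
  unfolding line_integral_eq
  by (intro nn_integral_sum measurable_compose[OF arc_borel_measurable[OF assms(1)] assms(2)])

lemma line_integral_add:
  assumes "arc_length_curve \<gamma> l" "g \<in> borel_measurable borel" "h \<in> borel_measurable borel"
  shows "line_integral \<gamma> l (\<lambda>z. g z + h z) = line_integral \<gamma> l g + line_integral \<gamma> l h"
  unfolding line_integral_eq
  by (intro nn_integral_add measurable_compose[OF arc_borel_measurable[OF assms(1)]] assms(2,3))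

lemma line_integral_cmult:
  assumes "arc_length_curve \<gamma> l" "g \<in> borel_measurable borel"
  shows "line_integral \<gamma> l (\<lambda>z. c * g z) = c * line_integral \<gamma> l g"
  unfolding line_integral_eq
  by (intro nn_integral_cmult measurable_compose[OF arc_borel_measurable[OF assms(1)] assms(2)])

text \<open>
  A function with Lipschitz constant 1 cannot cross the band between \<open>a\<close> and \<open>b\<close> faster than at
  unit speed. This replaces the differentiation of an absolutely continuous function along a curve.
\<close>
lemma level_set_measure_ge:
  fixes f :: "real \<Rightarrow> real"
  assumes lip: "\<And>s t. s \<in> {0..l} \<Longrightarrow> t \<in> {0..l} \<Longrightarrow> \<bar>f s - f t\<bar> \<le> \<bar>s - t\<bar>"
    and "a \<le> b" "s \<in> {0..l}" "t \<in> {0..l}"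
  shows "ennreal \<bar>max a (min b (f s)) - max a (min b (f t))\<bar>
           \<le> emeasure lebesgue {\<tau>\<in>{0..l}. a \<le> f \<tau> \<and> f \<tau> \<le> b}"
proof -
  have rising: "ennreal (max a (min b (f t)) - max a (min b (f s)))
           \<le> emeasure lebesgue {\<tau>\<in>{0..l}. a \<le> f \<tau> \<and> f \<tau> \<le> b}"
    if lip: "\<And>s t. s \<in> {0..l} \<Longrightarrow> t \<in> {0..l} \<Longrightarrow> \<bar>f s - f t\<bar> \<le> \<bar>s - t\<bar>"
      and ord: "a \<le> b" "0 \<le> s" "s \<le> t" "t \<le> l" for f :: "real \<Rightarrow> real" and a b s t
  proof -
    define \<alpha> where "\<alpha> = max a (min b (f s))"
    define \<beta> where "\<beta> = max a (min b (f t))"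
    have cont: "continuous_on {0..l} f"
      by (rule lipschitz_on_continuous_on[of 1])
        (use lip ord(2-4) in \<open>auto simp: lipschitz_on_def dist_real_def\<close>)
    show ?thesis
    proof (cases "\<alpha> < \<beta>")
      case True
      then have ab: "f s \<le> \<alpha>" "\<beta> \<le> f t" "a \<le> \<alpha>" "\<beta> \<le> b"
        using \<open>a \<le> b\<close> by (auto simp: \<alpha>_def \<beta>_def max_def min_def split: if_splits)
      obtain s' t' where st': "s \<le> s'" "s' \<le> t'" "t' \<le> t" "f s' = \<alpha>" "f t' = \<beta>"
          "f ` {s'..t'} \<subseteq> {\<alpha>..\<beta>}"
        using crossing_interval[of s t f \<alpha> \<beta>] ab True ord(2-4) continuous_on_subset[OF cont, of "{s..t}"]
        by auto
      have "\<beta> - \<alpha> \<le> t' - s'"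
        using lip[of t' s'] st' ord(2-4) True by auto
      then have "ennreal (\<beta> - \<alpha>) \<le> emeasure lebesgue {s'..t'}"
        using st'(2) by (simp add: ennreal_leI)
      also have "\<dots> \<le> emeasure lebesgue {\<tau>\<in>{0..l}. a \<le> f \<tau> \<and> f \<tau> \<le> b}"
      proof (rule emeasure_mono)
        show "{s'..t'} \<subseteq> {\<tau>\<in>{0..l}. a \<le> f \<tau> \<and> f \<tau> \<le> b}"
          using st' ab(3,4) ord(2-4) by force
        have "{\<tau>\<in>{0..l}. a \<le> f \<tau> \<and> f \<tau> \<le> b} = {0..l} \<inter> f -` {a..b}" by auto
        also have "closed \<dots>" by (intro continuous_closed_preimage cont) auto
        then have "{0..l} \<inter> f -` {a..b} \<in> sets lebesgue" by (simp add: borel_closed)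
        finally show "{\<tau>\<in>{0..l}. a \<le> f \<tau> \<and> f \<tau> \<le> b} \<in> sets lebesgue" .
      qed
      finally show ?thesis by (simp add: \<alpha>_def \<beta>_def)
    next
      case False
      then have "max a (min b (f t)) - max a (min b (f s)) \<le> 0"
        by (simp only: \<alpha>_def \<beta>_def)
      then show ?thesis by (simp only: ennreal_neg zero_le)
    qed
  qed
  \<comment> \<open>A falling stretch of \<open>f\<close> is a rising stretch of \<open>- f\<close>.\<close>
  have any: "ennreal \<bar>max a (min b (f s)) - max a (min b (f t))\<bar>
           \<le> emeasure lebesgue {\<tau>\<in>{0..l}. a \<le> f \<tau> \<and> f \<tau> \<le> b}"
    if "0 \<le> s" "s \<le> t" "t \<le> l" for s t
  proof (cases "max a (min b (f s)) \<le> max a (min b (f t))")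
    case True
    then have "\<bar>max a (min b (f s)) - max a (min b (f t))\<bar> = max a (min b (f t)) - max a (min b (f s))"
      by linarith
    then show ?thesis using rising[of f, OF lip \<open>a \<le> b\<close> that] by (simp only:)
  next
    case False
    have clamp_neg: "max (-b) (min (-a) (- v)) = - max a (min b v)" for v
      using \<open>a \<le> b\<close> by (auto simp: max_def min_def)
    have lip': "\<bar>- f s - - f t\<bar> \<le> \<bar>s - t\<bar>" if "s \<in> {0..l}" "t \<in> {0..l}" for s t
      using lip[OF that] by simp
    have "{\<tau>\<in>{0..l}. - b \<le> - f \<tau> \<and> - f \<tau> \<le> - a} = {\<tau>\<in>{0..l}. a \<le> f \<tau> \<and> f \<tau> \<le> b}"
      by auto
    moreover have "\<bar>max a (min b (f s)) - max a (min b (f t))\<bar>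
        = - max a (min b (f t)) - - max a (min b (f s))"
      using False by linarith
    ultimately show ?thesis
      using rising[of "\<lambda>t. - f t" "- b" "- a", OF lip' _ that] \<open>a \<le> b\<close>
      by (simp only: clamp_neg neg_le_iff_le)
  qed
  show ?thesis
  proof (cases "s \<le> t")
    case True
    then show ?thesis using any[of s t] assms(3,4) by simp
  next
    case False
    then show ?thesis using any[of t s] assms(3,4) by (simp only: abs_minus_commute) simp
  qed
qed

definition annulus :: "'a::metric_space \<Rightarrow> real \<Rightarrow> real \<Rightarrow> 'a set" where
  "annulus x a b = {z. a \<le> dist x z \<and> dist x z \<le> b}"

lemma closed_annulus: "closed (annulus x a b)"
  unfolding annulus_def by (intro closed_Collect_conj closed_Collect_le continuous_intros)

lemma annulus_borel [measurable]: "annulus x a b \<in> sets borel"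
  by (simp add: closed_annulus borel_closed)

text \<open>
  The indicator of the annulus is thus an upper gradient of the distance from \<open>x\<close>
  truncated at the two radii; the ramps of the cutoff below are rescaled copies of this function.
\<close>
lemma clamped_dist_diff_le:
  assumes "arc_length_curve \<gamma> l" "a \<le> b" "s \<in> {0..l}" "t \<in> {0..l}"
  shows "ennreal \<bar>max a (min b (dist x (\<gamma> s))) - max a (min b (dist x (\<gamma> t)))\<bar>
           \<le> line_integral \<gamma> l (indicator (annulus x a b))"
proof -
  let ?f = "\<lambda>t. dist x (\<gamma> t)"
  have lip: "\<bar>?f s - ?f t\<bar> \<le> \<bar>s - t\<bar>" if "s \<in> {0..l}" "t \<in> {0..l}" for s t
    using arc_length_curve_dist_le[OF assms(1) that] abs_dist_diff_le[of "\<gamma> s" x "\<gamma> t"]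
    by (simp add: dist_commute)
  have "line_integral \<gamma> l (indicator (annulus x a b))
      = (\<integral>\<^sup>+t. indicator {\<tau>\<in>{0..l}. a \<le> ?f \<tau> \<and> ?f \<tau> \<le> b} t \<partial>lebesgue)"
    unfolding line_integral_def
    by (intro nn_integral_cong) (auto simp: annulus_def indicator_def)
  also have "\<dots> = emeasure lebesgue {\<tau>\<in>{0..l}. a \<le> ?f \<tau> \<and> ?f \<tau> \<le> b}"
  proof (rule nn_integral_indicator)
    have "continuous_on {0..l} ?f"
      using assms(1) by (intro continuous_intros) (simp add: arc_length_curve_def)
    then have "closed ({0..l} \<inter> ?f -` {a..b})" by (intro continuous_closed_preimage) auto
    moreover have "{\<tau>\<in>{0..l}. a \<le> ?f \<tau> \<and> ?f \<tau> \<le> b} = {0..l} \<inter> ?f -` {a..b}" by auto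
    ultimately show "{\<tau>\<in>{0..l}. a \<le> ?f \<tau> \<and> ?f \<tau> \<le> b} \<in> sets lebesgue"
      by (simp add: borel_closed)
  qed
  finally show ?thesis
    using level_set_measure_ge[of l ?f, OF lip assms(2-4)] by simp
qed

section \<open>Upper gradients of functions cut off along components\<close>

text \<open>
  The indicator of \<open>E\<close> costs no gradient when \<open>E\<close> does not split any connected set on which
  \<open>\<eta>\<close> is positive. A curve either avoids the zeros of \<open>\<eta>\<close>, hence stays on one side of \<open>E\<close>, or meets such a
  zero; in the second case the oscillation of \<open>\<eta>\<close> along the curve already dominates both
  end values. The inequality holds for every curve, so the exceptional family is empty.
\<close>
lemma weak_upper_gradient_restrict:
  fixes \<eta> :: "'a::metric_space \<Rightarrow> real"
  assumes "metric_measure_space M"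
    and g: "g \<in> borel_measurable borel"
    and nonneg: "\<And>z. 0 \<le> \<eta> z"
    and osc: "\<And>\<gamma> l s t. arc_length_curve \<gamma> l \<Longrightarrow> s \<in> {0..l} \<Longrightarrow> t \<in> {0..l} \<Longrightarrow>
                ennreal \<bar>\<eta> (\<gamma> s) - \<eta> (\<gamma> t)\<bar> \<le> line_integral \<gamma> l g"
    and sep: "\<And>T. connected T \<Longrightarrow> T \<subseteq> {z. 0 < \<eta> z} \<Longrightarrow> T \<inter> E \<noteq> {} \<Longrightarrow> T \<subseteq> E"
  shows "weak_upper_gradient M q (\<lambda>z. ereal (\<eta> z * indicator E z)) g"
  unfolding weak_upper_gradient_def
proof
  interpret metric_measure_space M by fact
  show "g \<in> borel_measurable M"
    using g borel_sets space_eq by (auto simp: measurable_def)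
  define u where "u z = \<eta> z * indicator E z" for z
  have u_nonneg: "0 \<le> u z" and u_le: "u z \<le> \<eta> z" for z
    using nonneg by (auto simp: u_def indicator_def)
  have bound: "ennreal \<bar>u (\<gamma> 0) - u (\<gamma> l)\<bar> \<le> line_integral \<gamma> l g"
    if arc: "arc_length_curve \<gamma> l" for \<gamma> l
  proof (cases "\<exists>t\<in>{0..l}. \<eta> (\<gamma> t) = 0")
    case True
    then obtain t where t: "t \<in> {0..l}" "\<eta> (\<gamma> t) = 0" by blast
    have "0 < l" using arc by (simp add: arc_length_curve_def)
    have "\<bar>u (\<gamma> 0) - u (\<gamma> l)\<bar> \<le> max (\<eta> (\<gamma> 0)) (\<eta> (\<gamma> l))"
      using u_nonneg[of "\<gamma> 0"] u_nonneg[of "\<gamma> l"] u_le[of "\<gamma> 0"] u_le[of "\<gamma> l"] by linarith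
    then have "ennreal \<bar>u (\<gamma> 0) - u (\<gamma> l)\<bar> \<le> ennreal (max (\<eta> (\<gamma> 0)) (\<eta> (\<gamma> l)))"
      by (rule ennreal_leI)
    also have "\<dots> \<le> line_integral \<gamma> l g"
      using osc[OF arc _ t(1), of 0] osc[OF arc _ t(1), of l] \<open>0 < l\<close> nonneg t(2)
      by (auto simp: max_def)
    finally show ?thesis .
  next
    case False
    have "connected (\<gamma> ` {0..l})"
      using arc by (intro connected_continuous_image) (auto simp: arc_length_curve_def)
    moreover have "\<gamma> ` {0..l} \<subseteq> {z. 0 < \<eta> z}"
      using False nonneg by (force simp: less_le)
    ultimately have "\<gamma> ` {0..l} \<subseteq> E \<or> \<gamma> ` {0..l} \<inter> E = {}" using sep by blast
    moreover have l: "0 \<in> {0..l}" "l \<in> {0..l}" using arc by (auto simp: arc_length_curve_def)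
    ultimately have "\<bar>u (\<gamma> 0) - u (\<gamma> l)\<bar> \<le> \<bar>\<eta> (\<gamma> 0) - \<eta> (\<gamma> l)\<bar>"
      by (fastforce simp: u_def indicator_def)
    then show ?thesis using osc[OF arc l] by (meson ennreal_leI order_trans)
  qed
  show "ae_curve M q (\<lambda>\<gamma> l. (\<lambda>t. g (\<gamma> t)) \<in> borel_measurable (lebesgue_on {0..l}) \<and>
          ereal_diff (ereal (\<eta> (\<gamma> 0) * indicator E (\<gamma> 0))) (ereal (\<eta> (\<gamma> l) * indicator E (\<gamma> l)))
            \<le> line_integral \<gamma> l g)"
    unfolding ae_curve_def
  proof (intro bexI[of _ "\<lambda>_. 0"] conjI)
    show "(\<integral>\<^sup>+x. ennreal_powr 0 q \<partial>M) < \<infinity>"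
      by (simp add: ennreal_powr_def)
    have "(\<lambda>t. g (\<gamma> t)) \<in> borel_measurable (lebesgue_on {0..l}) \<and>
          ereal_diff (ereal (\<eta> (\<gamma> 0) * indicator E (\<gamma> 0))) (ereal (\<eta> (\<gamma> l) * indicator E (\<gamma> l)))
            \<le> line_integral \<gamma> l g" if arc: "arc_length_curve \<gamma> l" for \<gamma> l
      using measurable_compose[OF arc_borel_measurable[OF arc] g] bound[OF arc]
      by (simp add: ereal_diff_def u_def)
    then show "\<forall>\<gamma> l. arc_length_curve \<gamma> l \<and>
          \<not> ((\<lambda>t. g (\<gamma> t)) \<in> borel_measurable (lebesgue_on {0..l}) \<and>
          ereal_diff (ereal (\<eta> (\<gamma> 0) * indicator E (\<gamma> 0))) (ereal (\<eta> (\<gamma> l) * indicator E (\<gamma> l)))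
            \<le> line_integral \<gamma> l g) \<longrightarrow> line_integral \<gamma> l (\<lambda>_. 0) = \<infinity>"
      by blast
  qed simp
qed

section \<open>Consequences of the Poincare inequality\<close>

text \<open>
  The Poincare inequality for bounded real functions. The mean value is only kept as some real
  number \<open>m\<close>, because every argument below works for any constant in its place.
\<close>
lemma poincare_bounded:
  assumes "metric_measure_space M" "supports_poincare M q dil"
  obtains C where "0 < C"
    "\<And>x r u g. 0 < r \<Longrightarrow> u \<in> borel_measurable borel \<Longrightarrow> (\<And>z. \<bar>u z\<bar> \<le> 1) \<Longrightarrow>
       weak_upper_gradient M q (\<lambda>z. ereal (u z)) g \<Longrightarrow>
       \<exists>m::real. (\<integral>\<^sup>+y\<in>ball x r. ennreal \<bar>u y - m\<bar> \<partial>M) / emeasure M (ball x r)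
         \<le> ennreal (C * r) *
           ennreal_powr ((\<integral>\<^sup>+y\<in>ball x (dil * r). ennreal_powr (g y) q \<partial>M)
                          / emeasure M (ball x (dil * r))) (1 / q)"
proof -
  interpret metric_measure_space M by fact
  obtain C where "0 < C" and C: "\<And>x r u g. 0 < r \<Longrightarrow> ereal_integrable_on M (ball x (dil * r)) u \<Longrightarrow>
        weak_upper_gradient M q u g \<Longrightarrow>
        (\<integral>\<^sup>+y\<in>ball x r. ereal_diff (u y) (ereal (mean M (ball x r) u)) \<partial>M)
            / emeasure M (ball x r)
        \<le> ennreal (C * r) *
           ennreal_powr ((\<integral>\<^sup>+y\<in>ball x (dil * r). ennreal_powr (g y) q \<partial>M)
                          / emeasure M (ball x (dil * r))) (1 / q)"
    using assms(2) unfolding supports_poincare_def by blast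
  have "1 \<le> dil" using assms(2) by (simp add: supports_poincare_def)
  show ?thesis
  proof (rule that[OF \<open>0 < C\<close>])
    fix x :: 'a and r :: real and g and u :: "'a \<Rightarrow> real"
    assume r: "0 < r" and u: "u \<in> borel_measurable borel" "\<And>z. \<bar>u z\<bar> \<le> 1"
      and g: "weak_upper_gradient M q (\<lambda>z. ereal (u z)) g"
    have uM: "u \<in> borel_measurable M"
      using u(1) borel_sets space_eq by (auto simp: measurable_def)
    have "(\<integral>\<^sup>+z\<in>ball x (dil * r). e2ennreal \<bar>ereal (u z)\<bar> \<partial>M)
        \<le> (\<integral>\<^sup>+z. indicator (ball x (dil * r)) z \<partial>M)"
    proof (rule nn_integral_mono)
      show "e2ennreal \<bar>ereal (u z)\<bar> * indicator (ball x (dil * r)) z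
          \<le> indicator (ball x (dil * r)) z" for z
        using u(2)[of z] by (auto simp: indicator_def)
    qed
    also have "\<dots> = emeasure M (ball x (dil * r))"
      using borel_sets by (intro nn_integral_indicator) auto
    also have "\<dots> < \<infinity>" using r \<open>1 \<le> dil\<close> by (intro ball_finite) simp
    finally have "ereal_integrable_on M (ball x (dil * r)) (\<lambda>z. ereal (u z))"
      unfolding ereal_integrable_on_def using uM
      by (auto intro!: measurable_restrict_space1)
    from C[OF r this g]
    show "\<exists>m::real. (\<integral>\<^sup>+y\<in>ball x r. ennreal \<bar>u y - m\<bar> \<partial>M) / emeasure M (ball x r)
         \<le> ennreal (C * r) *
           ennreal_powr ((\<integral>\<^sup>+y\<in>ball x (dil * r). ennreal_powr (g y) q \<partial>M)
                          / emeasure M (ball x (dil * r))) (1 / q)"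
      by (auto simp: ereal_diff_def)
  qed
qed

text \<open>
  The Poincare inequality makes \<open>u\<close> almost everywhere constant on the ball of radius \<open>s\<close>, and the
  constant can be read off on a smaller concentric ball, which has positive measure however small
  its radius \<open>t\<close> is.
\<close>
lemma zero_gradient_imp_constant:
  fixes u :: "'a::metric_space \<Rightarrow> real"
  assumes mm: "metric_measure_space M" and PI: "supports_poincare M q dil"
    and u: "u \<in> borel_measurable borel" "\<And>z. \<bar>u z\<bar> \<le> 1"
    and g: "weak_upper_gradient M q (\<lambda>z. ereal (u z)) g"
    and zero: "\<And>z. z \<in> ball x (dil * s) \<Longrightarrow> g z = 0"
    and t: "0 < t" "t \<le> s" "\<And>z. z \<in> ball x t \<Longrightarrow> u z = v"
  shows "AE z in M. z \<in> ball x s \<longrightarrow> u z = v"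
proof -
  interpret metric_measure_space M by fact
  have s: "0 < s" using t by simp
  have bM: "ball y \<rho> \<in> sets M" for y \<rho> using borel_sets by auto
  have uM: "u \<in> borel_measurable M"
    using u(1) borel_sets space_eq by (auto simp: measurable_def)
  obtain C where "\<exists>m::real. (\<integral>\<^sup>+y\<in>ball x s. ennreal \<bar>u y - m\<bar> \<partial>M) / emeasure M (ball x s)
         \<le> ennreal (C * s) *
           ennreal_powr ((\<integral>\<^sup>+y\<in>ball x (dil * s). ennreal_powr (g y) q \<partial>M)
                          / emeasure M (ball x (dil * s))) (1 / q)"
    by (rule poincare_bounded[OF mm PI]) (use s u g in blast)
  then obtain m where C: "(\<integral>\<^sup>+y\<in>ball x s. ennreal \<bar>u y - m\<bar> \<partial>M) / emeasure M (ball x s)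
         \<le> ennreal (C * s) *
           ennreal_powr ((\<integral>\<^sup>+y\<in>ball x (dil * s). ennreal_powr (g y) q \<partial>M)
                          / emeasure M (ball x (dil * s))) (1 / q)"
    by blast
  have "(\<integral>\<^sup>+y\<in>ball x (dil * s). ennreal_powr (g y) q \<partial>M) = (\<integral>\<^sup>+y. 0 \<partial>M)"
    by (intro nn_integral_cong) (auto simp: indicator_def zero ennreal_powr_def)
  with C have "(\<integral>\<^sup>+y\<in>ball x s. ennreal \<bar>u y - m\<bar> \<partial>M) / emeasure M (ball x s) = 0"
    by (simp add: ennreal_powr_def)
  then have "(\<integral>\<^sup>+y\<in>ball x s. ennreal \<bar>u y - m\<bar> \<partial>M) = 0"
    using ball_finite[OF s, of x] by (auto simp: ennreal_divide_eq_0_iff)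
  then have "AE y in M. ennreal \<bar>u y - m\<bar> * indicator (ball x s) y = 0"
    using uM bM by (subst (asm) nn_integral_0_iff_AE) auto
  then have m: "AE y in M. y \<in> ball x s \<longrightarrow> u y = m"
    by eventually_elim (auto simp: indicator_def)
  have "v = m"
  proof (rule ccontr)
    assume "v \<noteq> m"
    from m have "AE y in M. y \<notin> ball x t"
      by eventually_elim (use t \<open>v \<noteq> m\<close> in auto)
    then have "emeasure M (ball x t) = 0"
      using bM by (subst (asm) AE_iff_measurable[where N = "ball x t"]) (auto simp: space_eq)
    with ball_pos[OF t(1), of x] show False by simp
  qed
  with m show ?thesis by simp
qed

text \<open>
  Every real number \<open>m\<close> is at distance at least \<open>1/2\<close> from 0 or from 1.
\<close>
lemma oscillation_ge:
  fixes u :: "'a \<Rightarrow> real"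
  assumes F: "F \<in> sets M" "F \<subseteq> B" "AE z in M. z \<in> F \<longrightarrow> u z = 1" "\<kappa> \<le> emeasure M F"
    and G: "G \<in> sets M" "G \<subseteq> B" "AE z in M. z \<in> G \<longrightarrow> u z = 0" "\<kappa> \<le> emeasure M G"
  shows "ennreal (1/2) * \<kappa> \<le> (\<integral>\<^sup>+y\<in>B. ennreal \<bar>u y - m\<bar> \<partial>M)"
proof -
  have half: "ennreal (1/2) * \<kappa> \<le> (\<integral>\<^sup>+y\<in>B. ennreal \<bar>u y - m\<bar> \<partial>M)"
    if H: "H \<in> sets M" "H \<subseteq> B" "AE z in M. z \<in> H \<longrightarrow> u z = v" "\<kappa> \<le> emeasure M H" "1/2 \<le> \<bar>v - m\<bar>"
    for H v
  proof -
    have le: "ennreal (1/2) \<le> ennreal \<bar>v - m\<bar>" using H(5) by (rule ennreal_leI)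
    have "ennreal (1/2) * \<kappa> \<le> ennreal (1/2) * emeasure M H" by (rule mult_left_mono[OF H(4)]) simp
    also have "\<dots> = (\<integral>\<^sup>+y. ennreal (1/2) * indicator H y \<partial>M)"
      by (rule nn_integral_cmult_indicator[symmetric, OF H(1)])
    also have "\<dots> \<le> (\<integral>\<^sup>+y\<in>B. ennreal \<bar>u y - m\<bar> \<partial>M)"
    proof (rule nn_integral_mono_AE)
      show "AE y in M. ennreal (1/2) * indicator H y \<le> ennreal \<bar>u y - m\<bar> * indicator B y"
        using H(3) by eventually_elim (use H(2) le in \<open>auto simp: indicator_def\<close>)
    qed
    finally show ?thesis .
  qed
  show ?thesis
  proof (cases "1/2 \<le> m")
    case True
    then show ?thesis using half[OF G] by simp
  next
    case False
    then show ?thesis using half[OF F] by simp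
  qed
qed

lemma doubling_iterate:
  assumes "\<And>x r. 0 < r \<Longrightarrow> measure M (ball x (2 * r)) \<le> D * measure M (ball x r)" "0 < D" "0 < r"
  shows "measure M (ball x (2 ^ k * r)) \<le> D ^ k * measure M (ball x r)"
proof (induction k)
  case (Suc k)
  have "measure M (ball x (2 ^ Suc k * r)) \<le> D * measure M (ball x (2 ^ k * r))"
    using assms(1)[of "2 ^ k * r" x] assms(3) by (simp add: mult.assoc)
  also have "\<dots> \<le> D * (D ^ k * measure M (ball x r))"
    using Suc.IH assms(2) by (intro mult_left_mono) auto
  finally show ?case by (simp add: mult.assoc)
qed simp

lemma ennreal_powr_le:
  assumes "a \<le> ennreal b" "0 \<le> b" "0 < q"
  shows "ennreal_powr a q \<le> ennreal (b powr q)"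
proof -
  have "a \<noteq> \<infinity>" using assms(1) by (auto simp: top_unique)
  moreover have "enn2real a \<le> b" using assms(1,2) by (rule enn2real_leI[rotated])
  ultimately show ?thesis
    using assms by (auto simp: ennreal_powr_def intro!: ennreal_leI powr_mono2)
qed

section \<open>The logarithmic cutoff\<close>

definition ramp :: "real \<Rightarrow> real \<Rightarrow> real" where
  "ramp a v = (max a (min (2 * a) v) - a) / a"

lemma ramp_bounds: "0 < a \<Longrightarrow> 0 \<le> ramp a v" "0 < a \<Longrightarrow> ramp a v \<le> 1"
  by (auto simp: ramp_def)

lemma ramp_eq: "0 < a \<Longrightarrow> v \<le> a \<Longrightarrow> ramp a v = 0" "0 < a \<Longrightarrow> 2 * a \<le> v \<Longrightarrow> ramp a v = 1"
  by (auto simp: ramp_def)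

text \<open>
  The average of \<open>N\<close> ramps across the annuli between the radii \<open>r / 4 ^ i\<close> and \<open>2 * (r / 4 ^ i)\<close>
  is a discrete version of a logarithmic function of the distance from \<open>x0\<close>. The last term brings
  the function back to 0 between the radii \<open>R\<close> and \<open>2 * R\<close>.
\<close>
definition log_cutoff :: "'a::metric_space \<Rightarrow> real \<Rightarrow> nat \<Rightarrow> real \<Rightarrow> 'a \<Rightarrow> real" where
  "log_cutoff x0 r N R z =
     (\<Sum>i=1..N. ramp (r / 4 ^ i) (dist x0 z)) / real N - ramp R (dist x0 z)"

definition log_cutoff_gradient :: "'a::metric_space \<Rightarrow> real \<Rightarrow> nat \<Rightarrow> real \<Rightarrow> 'a \<Rightarrow> ennreal" where
  "log_cutoff_gradient x0 r N R z =
     (\<Sum>i=1..N. ennreal (4 ^ i / (real N * r)) * indicator (annulus x0 (r / 4 ^ i) (2 * (r / 4 ^ i))) z)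
     + ennreal (1 / R) * indicator (annulus x0 R (2 * R)) z"

lemma layer_radius_le: 
  assumes "0 < r" "i \<in> {1..N}" shows "r / 4 ^ i \<le> r / (4::real)" "r / 4 ^ N \<le> r / (4::real) ^ i"
proof -
  have "(4::real) ^ 1 \<le> 4 ^ i" "(4::real) ^ i \<le> 4 ^ N"
    using assms(2) by (intro power_increasing; simp)+
  then show "r / 4 ^ i \<le> r / (4::real)" "r / 4 ^ N \<le> r / (4::real) ^ i"
    using assms(1) by (intro divide_left_mono; simp)+
qed

context
  fixes x0 :: "'a::metric_space" and r R :: real and N :: nat
  assumes r: "0 < r" and N: "1 \<le> N" and R: "r \<le> R"
begin

lemma log_cutoff_inner_eq:
  assumes "r / 2 \<le> v"
  shows "(\<Sum>i=1..N. ramp (r / 4 ^ i) v) = real N"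
proof -
  have "ramp (r / 4 ^ i) v = 1" if "i \<in> {1..N}" for i
    using layer_radius_le(1)[OF r that] r assms by (intro ramp_eq(2)) (simp, linarith)
  then show ?thesis by simp
qed

lemma log_cutoff_eq_1:
  assumes "r / 2 \<le> dist x0 z" "dist x0 z \<le> R"
  shows "log_cutoff x0 r N R z = 1"
  using log_cutoff_inner_eq[OF assms(1)] ramp_eq(1)[of R "dist x0 z"] assms r R N
  by (simp add: log_cutoff_def)

lemma log_cutoff_nonneg: "0 \<le> log_cutoff x0 r N R z"
proof (cases "dist x0 z \<le> R")
  case True
  then show ?thesis
    using r R ramp_eq(1)[of R "dist x0 z"]
    by (auto simp: log_cutoff_def intro!: sum_nonneg divide_nonneg_nonneg ramp_bounds)
next
  case False
  then show ?thesis
    using log_cutoff_inner_eq[of "dist x0 z"] ramp_bounds(2)[of R "dist x0 z"] r R N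
    by (simp add: log_cutoff_def)
qed

lemma log_cutoff_le_1: "log_cutoff x0 r N R z \<le> 1"
proof -
  have "(\<Sum>i=1..N. ramp (r / 4 ^ i) (dist x0 z)) \<le> (\<Sum>i=1..N. 1)"
    using r by (intro sum_mono ramp_bounds) simp
  then have "(\<Sum>i=1..N. ramp (r / 4 ^ i) (dist x0 z)) / real N \<le> 1"
    using N by (simp add: field_simps)
  then show ?thesis
    using ramp_bounds(1)[of R "dist x0 z"] r R by (simp add: log_cutoff_def)
qed

lemma log_cutoff_pos_imp:
  assumes "0 < log_cutoff x0 r N R z"
  shows "r / 4 ^ N < dist x0 z" "dist x0 z < 2 * R"
proof -
  show "r / 4 ^ N < dist x0 z"
  proof (rule ccontr)
    assume "\<not> r / 4 ^ N < dist x0 z"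
    then have "ramp (r / 4 ^ i) (dist x0 z) = 0" if "i \<in> {1..N}" for i
      using layer_radius_le(2)[OF r that] r by (intro ramp_eq) auto
    then show False using assms ramp_bounds(1)[of R "dist x0 z"] r R by (simp add: log_cutoff_def)
  qed
  show "dist x0 z < 2 * R"
  proof (rule ccontr)
    assume "\<not> dist x0 z < 2 * R"
    then show False
      using log_cutoff_inner_eq[of "dist x0 z"] ramp_eq(2)[of R "dist x0 z"] r R N assms
      by (simp add: log_cutoff_def)
  qed
qed

lemma continuous_on_log_cutoff: "continuous_on S (log_cutoff x0 r N R)"
  unfolding log_cutoff_def ramp_def
  by (intro continuous_intros) (use r R N in auto)

lemma log_cutoff_gradient_borel: "log_cutoff_gradient x0 r N R \<in> borel_measurable borel"
  unfolding log_cutoff_gradient_def by measurable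

lemma log_cutoff_gradient_eq_0:
  assumes "r / 2 < dist x0 z" "dist x0 z < R"
  shows "log_cutoff_gradient x0 r N R z = 0"
proof -
  have "z \<notin> annulus x0 (r / 4 ^ i) (2 * (r / 4 ^ i))" if "i \<in> {1..N}" for i
  proof -
    have "2 * (r / 4 ^ i) \<le> r / 2" using layer_radius_le(1)[OF r that] by linarith
    with assms(1) show ?thesis unfolding annulus_def by (simp only: mem_Collect_eq) linarith
  qed
  moreover have "z \<notin> annulus x0 R (2 * R)" using assms(2) by (auto simp: annulus_def)
  ultimately show ?thesis by (auto simp: log_cutoff_gradient_def)
qed

lemma log_cutoff_osc_le:
  assumes "arc_length_curve \<gamma> l" "s \<in> {0..l}" "t \<in> {0..l}"
  shows "ennreal \<bar>log_cutoff x0 r N R (\<gamma> s) - log_cutoff x0 r N R (\<gamma> t)\<bar>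
           \<le> line_integral \<gamma> l (log_cutoff_gradient x0 r N R)"
proof -
  let ?L = "\<lambda>a. line_integral \<gamma> l (indicator (annulus x0 a (2 * a)))"
  define d where "d a = \<bar>ramp a (dist x0 (\<gamma> s)) - ramp a (dist x0 (\<gamma> t))\<bar>" for a
  have d: "ennreal (c * d a) \<le> ennreal (c / a) * ?L a" if "0 < a" "0 \<le> c" for a c
  proof -
    let ?m = "\<bar>max a (min (2 * a) (dist x0 (\<gamma> s))) - max a (min (2 * a) (dist x0 (\<gamma> t)))\<bar>"
    have "c * d a = (c / a) * ?m"
      using that by (simp add: d_def ramp_def diff_divide_distrib[symmetric] abs_divide)
    moreover have "ennreal ((c / a) * ?m) = ennreal (c / a) * ennreal ?m"
      using that by (intro ennreal_mult) auto
    ultimately have "ennreal (c * d a) = ennreal (c / a) * ennreal ?m"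
      by (simp only:)
    also have "\<dots> \<le> ennreal (c / a) * ?L a"
      using clamped_dist_diff_le[OF assms(1) _ assms(2,3)] that by (intro mult_left_mono) auto
    finally show ?thesis .
  qed
  have "\<bar>log_cutoff x0 r N R (\<gamma> s) - log_cutoff x0 r N R (\<gamma> t)\<bar>
      \<le> \<bar>\<Sum>i=1..N. ramp (r / 4 ^ i) (dist x0 (\<gamma> s)) - ramp (r / 4 ^ i) (dist x0 (\<gamma> t))\<bar> / real N + d R"
  proof -
    have "\<bar>A / n - B - (A' / n - B')\<bar> \<le> \<bar>A - A'\<bar> / n + \<bar>B - B'\<bar>" if "0 \<le> n" for A A' B B' n :: real
    proof -
      have "\<bar>A - A'\<bar> / n = \<bar>A / n - A' / n\<bar>" using that by (simp add: diff_divide_distrib[symmetric])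
      then show ?thesis by linarith
    qed
    then show ?thesis unfolding log_cutoff_def d_def sum_subtractf by simp
  qed
  also have "\<dots> \<le> (\<Sum>i=1..N. d (r / 4 ^ i)) / real N + d R"
    unfolding d_def by (intro add_mono divide_right_mono sum_abs) auto
  also have "\<dots> = (\<Sum>i=1..N. 1 / real N * d (r / 4 ^ i)) + 1 * d R"
    by (simp add: sum_divide_distrib)
  finally have "ennreal \<bar>log_cutoff x0 r N R (\<gamma> s) - log_cutoff x0 r N R (\<gamma> t)\<bar>
      \<le> ennreal ((\<Sum>i=1..N. 1 / real N * d (r / 4 ^ i)) + 1 * d R)"
    by (rule ennreal_leI)
  also have "\<dots> = (\<Sum>i=1..N. ennreal (1 / real N * d (r / 4 ^ i))) + ennreal (1 * d R)"
    by (subst ennreal_plus) (auto simp: d_def sum_ennreal intro!: sum_nonneg)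
  also have "\<dots> \<le> (\<Sum>i=1..N. ennreal (1 / real N / (r / 4 ^ i)) * ?L (r / 4 ^ i)) + ennreal (1 / R) * ?L R"
    using r R by (intro add_mono sum_mono d) auto
  also have "\<dots> = (\<Sum>i=1..N. ennreal (4 ^ i / (real N * r)) * ?L (r / 4 ^ i)) + ennreal (1 / R) * ?L R"
    by simp
  also have "\<dots> = line_integral \<gamma> l (log_cutoff_gradient x0 r N R)"
    unfolding log_cutoff_gradient_def[abs_def]
    by (subst line_integral_add line_integral_sum line_integral_cmult, 
        use assms(1) in \<open>measurable | simp\<close>)+
  finally show ?thesis .
qed

end

text \<open>
  The ratio 4 of consecutive radii makes the annuli disjoint, so the power \<open>\<sigma>\<close> of the gradient is
  computed separately on each of them. On the \<open>i\<close>-th annulus the gradient is \<open>4 ^ i / (N * r)\<close>,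
  and by the volume condition the measure is at most a multiple of \<open>(r / 4 ^ i) powr \<sigma>\<close>. The
  product does not depend on \<open>i\<close>: each of the \<open>N\<close> layers contributes a multiple of
  \<open>N powr (- \<sigma>)\<close>.
\<close>
lemma log_cutoff_energy_le:
  fixes M :: "'a::metric_space measure"
  assumes "metric_measure_space M"
    and volume: "\<And>x s t. 0 < s \<Longrightarrow> s \<le> t \<Longrightarrow>
                   measure M (ball x s) / measure M (ball x t) \<le> C * (s / t) powr \<sigma>"
    and r: "0 < r" and N: "1 \<le> N" and R: "r \<le> R"
  shows "(\<integral>\<^sup>+z\<in>ball x0 R. ennreal_powr (log_cutoff_gradient x0 r N R z) \<sigma> \<partial>M)
           \<le> ennreal (C * real N * (4 / (real N * R)) powr \<sigma>) * emeasure M (ball x0 R)"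
proof -
  interpret metric_measure_space M by fact
  let ?a = "\<lambda>i. r / 4 ^ i :: real"
  let ?A = "\<lambda>i. annulus x0 (?a i) (2 * ?a i)"
  define c where "c i = 4 ^ i / (real N * r)" for i :: nat
  have c_pos: "0 \<le> c i" for i using r by (simp add: c_def)
  have AM: "?A i \<in> sets M" and BM: "ball x0 \<rho> \<in> sets M" for i \<rho>
    using borel_sets by auto
  have eball: "emeasure M (ball x0 \<rho>) = ennreal (measure M (ball x0 \<rho>))" if "0 < \<rho>" for \<rho>
    using ball_finite[OF that, of x0] by (intro emeasure_eq_ennreal_measure) auto
  have later: "z \<notin> ?A k" if "z \<in> ?A i" "i < k" for z i k
  proof -
    have "(4::real) ^ Suc i \<le> 4 ^ k" using that(2) by (intro power_increasing) auto
    then have "?a k \<le> r / 4 ^ Suc i" using r by (intro divide_left_mono) auto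
    also have "\<dots> = ?a i / 4" by simp
    finally have "?a k \<le> ?a i / 4" .
    moreover have "0 < ?a i" using r by simp
    moreover have "2 * b < a" if "b \<le> a / 4" "0 < a" for a b :: real using that by linarith
    ultimately have "2 * ?a k < ?a i" by blast
    then show ?thesis using that(1) by (simp only: annulus_def mem_Collect_eq) linarith
  qed
  then have disj: "i = k" if "z \<in> ?A i" "z \<in> ?A k" for z i k
    using that by (cases i k rule: linorder_cases) blast+
  have pointwise: "ennreal_powr (log_cutoff_gradient x0 r N R z) \<sigma> * indicator (ball x0 R) z
      \<le> (\<Sum>i=1..N. ennreal (c i powr \<sigma>) * indicator (?A i) z)" for z
  proof (cases "dist x0 z < R")
    case True
    then have g: "log_cutoff_gradient x0 r N R z = (\<Sum>i=1..N. ennreal (c i) * indicator (?A i) z)"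
      by (simp add: log_cutoff_gradient_def annulus_def c_def)
    show ?thesis
    proof (cases "\<exists>k\<in>{1..N}. z \<in> ?A k")
      case True
      then obtain k where k: "k \<in> {1..N}" "z \<in> ?A k" by blast
      have single: "(\<Sum>i=1..N. f i * indicator (?A i) z) = f k" for f :: "nat \<Rightarrow> ennreal"
      proof -
        have "(\<Sum>i=1..N. f i * indicator (?A i) z) = (\<Sum>i\<in>{k}. f i * indicator (?A i) z)"
        proof (rule sum.mono_neutral_right)
          have "z \<notin> ?A i" if "i \<noteq> k" for i using disj[OF _ k(2), of i] that by blast
          then show "\<forall>i\<in>{1..N} - {k}. f i * indicator (?A i) z = 0" by simp
        qed (use k(1) in auto)
        then show ?thesis using k(2) by (simp del: sum_mult_indicator)
      qed
      show ?thesis unfolding g single using c_pos[of k]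
        by (auto simp: ennreal_powr_def indicator_def)
    next
      case False
      then have "(\<Sum>i=1..N. ennreal (c i) * indicator (?A i) z) = 0"
        by (intro sum.neutral) (auto simp: indicator_def)
      then show ?thesis unfolding g by (simp add: ennreal_powr_def)
    qed
  qed simp
  have annulus_le: "emeasure M (?A i)
      \<le> ennreal (C * (4 * ?a i / R) powr \<sigma> * measure M (ball x0 R))" if "i \<in> {1..N}" for i
  proof -
    have "4 * b \<le> R" if "b \<le> r / 4" for b using that R by linarith
    with layer_radius_le(1)[OF r that] r have a: "0 < ?a i" "4 * ?a i \<le> R" by (simp, blast)
    have "emeasure M (?A i) \<le> emeasure M (ball x0 (4 * ?a i))"
      using a BM by (intro emeasure_mono) (auto simp: annulus_def)
    also have "\<dots> = ennreal (measure M (ball x0 (4 * ?a i)))" using a by (intro eball) simp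
    also have "\<dots> \<le> ennreal (C * (4 * ?a i / R) powr \<sigma> * measure M (ball x0 R))"
    proof (rule ennreal_leI)
      have "0 < measure M (ball x0 R)"
        using ball_pos[of R x0] eball[of R] r R by auto
      then show "measure M (ball x0 (4 * ?a i)) \<le> C * (4 * ?a i / R) powr \<sigma> * measure M (ball x0 R)"
        using volume[of "4 * ?a i" R x0] a by (simp add: divide_le_eq)
    qed
    finally show ?thesis .
  qed
  have "0 \<le> C" using volume[of 1 1 x0] ball_pos[of 1 x0] eball[of 1] by simp
  have "(\<integral>\<^sup>+z\<in>ball x0 R. ennreal_powr (log_cutoff_gradient x0 r N R z) \<sigma> \<partial>M)
      \<le> (\<integral>\<^sup>+z. (\<Sum>i=1..N. ennreal (c i powr \<sigma>) * indicator (?A i) z) \<partial>M)"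
    by (rule nn_integral_mono) (rule pointwise)
  also have "\<dots> = (\<Sum>i=1..N. ennreal (c i powr \<sigma>) * emeasure M (?A i))"
    using AM by (subst nn_integral_sum) (auto simp: nn_integral_cmult_indicator)
  also have "\<dots> \<le> (\<Sum>i=1..N. ennreal (C * (4 / (real N * R)) powr \<sigma> * measure M (ball x0 R)))"
  proof (rule sum_mono)
    fix i assume i: "i \<in> {1..N}"
    have "ennreal (c i powr \<sigma>) * emeasure M (?A i)
        \<le> ennreal (c i powr \<sigma>) * ennreal (C * (4 * ?a i / R) powr \<sigma> * measure M (ball x0 R))"
      by (intro mult_left_mono annulus_le i) simp
    also have "\<dots> = ennreal (c i powr \<sigma> * (C * (4 * ?a i / R) powr \<sigma> * measure M (ball x0 R)))"
      using \<open>0 \<le> C\<close> by (intro ennreal_mult[symmetric]) auto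
    also have "c i powr \<sigma> * (C * (4 * ?a i / R) powr \<sigma> * measure M (ball x0 R))
        = C * (c i * (4 * ?a i / R)) powr \<sigma> * measure M (ball x0 R)"
      using c_pos[of i] r R by (subst powr_mult) auto
    also have "c i * (4 * ?a i / R) = 4 / (real N * R)"
      using r R N by (simp add: c_def)
    finally show "ennreal (c i powr \<sigma>) * emeasure M (?A i)
        \<le> ennreal (C * (4 / (real N * R)) powr \<sigma> * measure M (ball x0 R))" .
  qed
  also have "\<dots> = ennreal (real N * (C * (4 / (real N * R)) powr \<sigma> * measure M (ball x0 R)))"
    using \<open>0 \<le> C\<close> by (simp add: ennreal_mult ennreal_of_nat_eq_real_of_nat)
  also have "\<dots> = ennreal (C * real N * (4 / (real N * R)) powr \<sigma>) * emeasure M (ball x0 R)"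
    using \<open>0 \<le> C\<close> r R by (simp add: eball ennreal_mult[symmetric] mult_ac)
  finally show ?thesis .
qed

text \<open>
  The left-hand side is a multiple of \<open>N powr (1 / \<sigma> - 1)\<close>, with a negative exponent.
\<close>
lemma many_layers:
  fixes \<sigma> :: real
  assumes "1 < \<sigma>" "0 < c" "0 \<le> C"
  obtains N :: nat where "1 \<le> N" "B * (C * real N) powr (1 / \<sigma>) / real N < c"
proof -
  have "(\<lambda>N. real N powr (1 / \<sigma> - 1)) \<longlonglongrightarrow> 0"
    using assms(1) by (intro tendsto_neg_powr filterlim_real_sequentially) (simp add: field_simps)
  then have "(\<lambda>N. B * C powr (1 / \<sigma>) * real N powr (1 / \<sigma> - 1)) \<longlonglongrightarrow> 0"
    by (rule tendsto_mult_right_zero)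
  then have "\<forall>\<^sub>F N in sequentially. B * C powr (1 / \<sigma>) * real N powr (1 / \<sigma> - 1) < c"
    using assms(2) by (rule order_tendstoD)
  then have "\<forall>\<^sub>F N in sequentially. 1 \<le> N \<and> B * C powr (1 / \<sigma>) * real N powr (1 / \<sigma> - 1) < c"
    using eventually_ge_at_top[of "1::nat"] by eventually_elim auto
  then obtain N :: nat where N: "1 \<le> N" "B * C powr (1 / \<sigma>) * real N powr (1 / \<sigma> - 1) < c"
    using eventually_sequentially by auto
  show ?thesis
  proof (rule that[OF N(1)])
    show "B * (C * real N) powr (1 / \<sigma>) / real N < c"
      using N assms(3) by (simp add: powr_mult powr_diff)
  qed
qed

section \<open>Chains in annuli\<close>

text \<open>
  One \<open>\<Lambda>\<close> serves every scale \<open>\<epsilon>\<close>. This matters because the scale required of annular chains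
  itself depends on \<open>\<Lambda>\<close>. The lower bound for the oscillation is therefore taken on
  balls whose radius \<open>h\<close> is a fixed multiple of \<open>r\<close>, and not on balls of radius \<open>\<epsilon>\<close>.
\<close>
lemma annular_chains_of_poincare:
  fixes M :: "'a::metric_space measure" and x0 :: 'a
  assumes mm: "metric_measure_space M"
    and doubling: "globally_doubling M"
    and \<sigma>: "1 < \<sigma>"
    and volume: "\<And>x s t. 0 < s \<Longrightarrow> s \<le> t \<Longrightarrow>
                   measure M (ball x s) / measure M (ball x t) \<le> C * (s / t) powr \<sigma>"
    and PI: "supports_poincare M \<sigma> dil"
  shows "\<exists>\<Lambda>>1. \<forall>r>0. \<forall>\<epsilon>>0. \<forall>x \<in> sphere x0 r. \<forall>y \<in> sphere x0 r.
           chain_connected (ball x0 (\<Lambda> * r) - ball x0 (r / \<Lambda>)) \<epsilon> x y"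
proof -
  interpret metric_measure_space M by fact
  have eball: "emeasure M (ball x \<rho>) = ennreal (measure M (ball x \<rho>))" if "0 < \<rho>" for x \<rho>
    using ball_finite[OF that, of x] by (intro emeasure_eq_ennreal_measure) auto
  have mball: "0 < measure M (ball x \<rho>)" if "0 < \<rho>" for x \<rho>
    using ball_pos[OF that, of x] eball[OF that, of x] by auto
  have BM: "ball x \<rho> \<in> sets M" for x \<rho> using borel_sets by auto
  have dil: "1 \<le> dil" using PI by (simp add: supports_poincare_def)
  have "0 \<le> C" using volume[of 1 1 x0] mball[of 1 x0] by simp
  obtain D where D: "0 < D" "\<And>x r. 0 < r \<Longrightarrow> measure M (ball x (2 * r)) \<le> D * measure M (ball x r)"
    using doubling unfolding globally_doubling_def by blast
  obtain P where P: "0 < P"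
    "\<And>x r u g. 0 < r \<Longrightarrow> u \<in> borel_measurable borel \<Longrightarrow> (\<And>z. \<bar>u z\<bar> \<le> 1) \<Longrightarrow>
       weak_upper_gradient M \<sigma> (\<lambda>z. ereal (u z)) g \<Longrightarrow>
       \<exists>m::real. (\<integral>\<^sup>+y\<in>ball x r. ennreal \<bar>u y - m\<bar> \<partial>M) / emeasure M (ball x r)
         \<le> ennreal (P * r) *
           ennreal_powr ((\<integral>\<^sup>+y\<in>ball x (dil * r). ennreal_powr (g y) \<sigma> \<partial>M)
                          / emeasure M (ball x (dil * r))) (1 / \<sigma>)"
    by (rule poincare_bounded[OF mm PI]) blast
  \<comment> \<open>The ball of radius \<open>2 * r\<close> about \<open>x0\<close> lies in the \<open>2 ^ k\<close>-fold dilation of any ball of radius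
    \<open>r / (2 * dil)\<close> centred on the sphere of radius \<open>r\<close>, so \<open>K\<close> compares their measures.\<close>
  obtain k :: nat where k: "8 * dil \<le> 2 ^ k"
    using real_arch_pow[of 2 "8 * dil"] less_imp_le by auto
  define K where "K = D ^ k"
  have K: "0 < K" using D(1) by (simp add: K_def)
  obtain N :: nat where N: "1 \<le> N" "4 * P / dil * (C * real N) powr (1 / \<sigma>) / real N < 1 / (2 * K)"
    using many_layers[of \<sigma> "1 / (2 * K)" C "4 * P / dil"] \<sigma> K \<open>0 \<le> C\<close> P(1) dil by auto
  define \<Lambda> where "\<Lambda> = 4 ^ N + 4 * dil"
  have \<Lambda>: "4 ^ N \<le> \<Lambda>" "4 * dil \<le> \<Lambda>" "1 < \<Lambda>" using dil by (auto simp: \<Lambda>_def add_strict_increasing2)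
  show ?thesis
  proof (intro exI[of _ \<Lambda>] conjI \<Lambda>(3) allI impI ballI, rule ccontr)
    fix r \<epsilon> :: real and x y
    assume r: "0 < r" and \<epsilon>: "0 < \<epsilon>" and "x \<in> sphere x0 r" "y \<in> sphere x0 r"
    then have x: "dist x0 x = r" and y: "dist x0 y = r" by simp_all
    define A where "A = ball x0 (\<Lambda> * r) - ball x0 (r / \<Lambda>)"
    assume "\<not> chain_connected (ball x0 (\<Lambda> * r) - ball x0 (r / \<Lambda>)) \<epsilon> x y"
    then have not_conn: "\<not> chain_connected A \<epsilon> x y" by (simp add: A_def)
    \<comment> \<open>The Poincare inequality on the ball of radius \<open>2 * r\<close> sees the gradient only up to the radius
      \<open>R\<close>, so the outer ramp of the cutoff has no influence on it.\<close>
    define R where "R = dil * (2 * r)"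
    have R: "2 * r \<le> R" "r \<le> R" using dil r by (auto simp: R_def mult_left_mono)
    define E where "E = {z. chain_connected A \<epsilon> x z}"
    define \<eta> where "\<eta> = log_cutoff x0 r N R"
    define g where "g = log_cutoff_gradient x0 r N R"
    define V where "V = {z. 0 < \<eta> z}"
    define u where "u z = \<eta> z * indicator E z" for z
    note cutoff = r N(1) R(2)
    have \<eta>_cont: "continuous_on UNIV \<eta>" unfolding \<eta>_def by (rule continuous_on_log_cutoff[OF cutoff])
    have V_open: "open V"
      unfolding V_def by (intro open_Collect_less continuous_intros \<eta>_cont)
    have "V \<subseteq> A"
    proof
      fix z assume "z \<in> V"
      then have "r / 4 ^ N < dist x0 z" "dist x0 z < 2 * R"
        using log_cutoff_pos_imp[OF cutoff] by (auto simp: V_def \<eta>_def)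
      moreover have "r / \<Lambda> \<le> r / 4 ^ N" using \<Lambda> r by (intro divide_left_mono) auto
      moreover have "2 * R \<le> \<Lambda> * r" using mult_right_mono[OF \<Lambda>(2), of r] r by (simp add: R_def mult_ac)
      ultimately show "z \<in> A" by (simp add: A_def)
    qed
    have sep: "T \<subseteq> E" if T: "connected T" "T \<subseteq> {z. 0 < \<eta> z}" "T \<inter> E \<noteq> {}" for T
    proof
      fix z assume "z \<in> T"
      obtain w where w: "w \<in> T" "w \<in> E" using T(3) by blast
      then have "chain_connected A \<epsilon> w z"
        using T \<open>V \<subseteq> A\<close> \<open>z \<in> T\<close> \<epsilon> by (intro connected_imp_chain_connected[of T]) (auto simp: V_def)
      with w(2) show "z \<in> E" unfolding E_def by (auto intro: rtranclp_trans)
    qed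
    have "open (E \<inter> V)"
      unfolding open_contains_ball
    proof
      fix z assume z: "z \<in> E \<inter> V"
      with V_open obtain d where d: "0 < d" "ball z d \<subseteq> V" unfolding open_contains_ball by auto
      have "ball z (min d \<epsilon>) \<subseteq> E \<inter> V"
      proof
        fix w assume w: "w \<in> ball z (min d \<epsilon>)"
        then have "w \<in> V" using d(2) by auto
        then have "chain_connected A \<epsilon> z w"
          using w z \<open>V \<subseteq> A\<close> by (intro r_into_rtranclp) auto
        with z \<open>w \<in> V\<close> show "w \<in> E \<inter> V" unfolding E_def by (auto intro: rtranclp_trans)
      qed
      then show "\<exists>e>0. ball z e \<subseteq> E \<inter> V" using d(1) \<epsilon> by (intro exI[of _ "min d \<epsilon>"]) auto
    qed
    have \<eta>_nonneg: "0 \<le> \<eta> z" and \<eta>_le: "\<eta> z \<le> 1" for z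
      unfolding \<eta>_def by (rule log_cutoff_nonneg[OF cutoff] log_cutoff_le_1[OF cutoff])+
    have u_borel: "u \<in> borel_measurable borel"
    proof -
      have "u = (\<lambda>z. \<eta> z * indicator (E \<inter> V) z)"
        using \<eta>_nonneg by (auto simp: u_def V_def indicator_def fun_eq_iff order.antisym not_less)
      also have "\<dots> \<in> borel_measurable borel"
        using \<open>open (E \<inter> V)\<close> \<eta>_cont
        by (intro borel_measurable_times borel_measurable_indicator borel_measurable_continuous_onI) auto
      finally show ?thesis .
    qed
    have u_bound: "\<bar>u z\<bar> \<le> 1" for z
      using \<eta>_nonneg[of z] \<eta>_le[of z] by (auto simp: u_def indicator_def)
    have u_grad: "weak_upper_gradient M \<sigma> (\<lambda>z. ereal (u z)) g"
      unfolding u_def g_def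
    proof (rule weak_upper_gradient_restrict[OF mm log_cutoff_gradient_borel[OF cutoff]])
      show "ennreal \<bar>\<eta> (\<gamma> s) - \<eta> (\<gamma> t)\<bar> \<le> line_integral \<gamma> l (log_cutoff_gradient x0 r N R)"
        if "arc_length_curve \<gamma> l" "s \<in> {0..l}" "t \<in> {0..l}" for \<gamma> l s t
        using log_cutoff_osc_le[OF cutoff that] by (simp add: \<eta>_def)
    qed (use \<eta>_nonneg sep in blast)+
    \<comment> \<open>The dilated ball of radius \<open>dil * h = r / 2\<close> about a point of the sphere stays in the region
      where the cutoff equals 1 and its gradient vanishes.\<close>
    define h where "h = r / (2 * dil)"
    have h: "0 < h" "h \<le> r / 2" "dil * h = r / 2"
      using r dil by (auto simp: h_def field_simps mult_left_mono)
    have near: "r / 2 < dist x0 z \<and> dist x0 z < R" if "dist x0 w = r" "z \<in> ball w (r / 2)" for w z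
      using that R r dist_triangle[of x0 z w] dist_triangle[of x0 w z] by (auto simp: dist_commute)
    have near_const: "AE z in M. z \<in> ball w h \<longrightarrow> u z = v"
      if w: "dist x0 w = r" and v: "\<And>z. z \<in> ball w (min h \<epsilon>) \<Longrightarrow> u z = v" for w v
    proof (rule zero_gradient_imp_constant[OF mm PI u_borel u_bound u_grad])
      show "g z = 0" if "z \<in> ball w (dil * h)" for z
        unfolding g_def using near[OF w, of z] that h(3)
        by (intro log_cutoff_gradient_eq_0[OF cutoff]) auto
      show "0 < min h \<epsilon>" "min h \<epsilon> \<le> h" using h(1) \<epsilon> by auto
    qed (rule v)
    have step: "chain_connected A \<epsilon> w z \<and> \<eta> z = 1"
      if w: "dist x0 w = r" and z: "z \<in> ball w (min h \<epsilon>)" for w z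
    proof -
      have inA: "\<eta> z' = 1 \<and> z' \<in> A" if "z' \<in> ball w h" for z'
      proof -
        have "z' \<in> ball w (r / 2)" using that h(2) by simp
        from near[OF w this] have "\<eta> z' = 1"
          unfolding \<eta>_def by (intro log_cutoff_eq_1[OF cutoff]) auto
        with \<open>V \<subseteq> A\<close> show ?thesis by (auto simp: V_def)
      qed
      show ?thesis using inA[of w] inA[of z] z h(1) by auto
    qed
    \<comment> \<open>The component \<open>E\<close> visibly contains a small ball about \<open>x\<close> and misses one about \<open>y\<close>. Since
      the gradient vanishes nearby, both facts extend to the radius \<open>h\<close> up to null sets.\<close>
    have "AE z in M. z \<in> ball x h \<longrightarrow> u z = 1"
    proof (rule near_const[OF x])
      show "u z = 1" if "z \<in> ball x (min h \<epsilon>)" for z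
        using step[OF x that] by (simp add: u_def E_def)
    qed
    moreover have "AE z in M. z \<in> ball y h \<longrightarrow> u z = 0"
    proof (rule near_const[OF y])
      show "u z = 0" if "z \<in> ball y (min h \<epsilon>)" for z
      proof -
        have "z \<notin> E"
          using step[OF y that] not_conn chain_connected_sym rtranclp_trans unfolding E_def by fast
        then show ?thesis by (simp add: u_def)
      qed
    qed
    moreover define B where "B = ball x0 (2 * r)"
    have mB: "0 < measure M B" unfolding B_def using r by (intro mball) simp
    have eB: "emeasure M B = ennreal (measure M B)" unfolding B_def using r by (intro eball) simp
    have fat: "ball w h \<subseteq> B \<and> ennreal (measure M B / K) \<le> emeasure M (ball w h)"
      if w: "dist x0 w = r" for w
    proof
      show "ball w h \<subseteq> B"
      proof
        fix z assume "z \<in> ball w h"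
        then show "z \<in> B" using h(2) r w dist_triangle[of x0 z w] by (simp add: B_def)
      qed
      have "4 * r \<le> 2 ^ k * h"
      proof -
        have "4 * r = 8 * dil * h" using h(3) by simp
        also have "\<dots> \<le> 2 ^ k * h" using k h(1) by (intro mult_right_mono) auto
        finally show ?thesis .
      qed
      have "B \<subseteq> ball w (2 ^ k * h)"
      proof
        fix z assume "z \<in> B"
        then show "z \<in> ball w (2 ^ k * h)"
          using \<open>4 * r \<le> 2 ^ k * h\<close> r w dist_triangle[of w z x0] by (simp add: B_def dist_commute)
      qed
      then have "measure M B \<le> measure M (ball w (2 ^ k * h))"
        using BM ball_finite[of "2 ^ k * h" w] h(1) by (intro measure_mono_fmeasurable) (auto simp: B_def fmeasurable_def)
      also have "\<dots> \<le> K * measure M (ball w h)"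
        unfolding K_def using doubling_iterate[of M D h w k] D h(1) by blast
      finally have "measure M B / K \<le> measure M (ball w h)" using K by (simp add: field_simps)
      then show "ennreal (measure M B / K) \<le> emeasure M (ball w h)"
        using eball[OF h(1)] by (simp add: ennreal_leI)
    qed
    ultimately have osc: "ennreal (1/2) * ennreal (measure M B / K) \<le> (\<integral>\<^sup>+z\<in>B. ennreal \<bar>u z - m\<bar> \<partial>M)" for m
      using fat[OF x] fat[OF y] by (intro oscillation_ge[where F = "ball x h" and G = "ball y h"] BM) auto
    obtain m where m: "(\<integral>\<^sup>+z\<in>B. ennreal \<bar>u z - m\<bar> \<partial>M) / emeasure M B
         \<le> ennreal (P * (2 * r)) *
           ennreal_powr ((\<integral>\<^sup>+z\<in>ball x0 R. ennreal_powr (g z) \<sigma> \<partial>M)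
                          / emeasure M (ball x0 R)) (1 / \<sigma>)"
      using P(2)[OF _ u_borel u_bound u_grad, of "2 * r" x0] r unfolding B_def R_def by auto
    have "ennreal (1 / (2 * K)) = ennreal (measure M B / (2 * K)) / emeasure M B"
      using mB K by (simp add: eB divide_ennreal)
    also have "ennreal (measure M B / (2 * K)) = ennreal (1/2) * ennreal (measure M B / K)"
      using mB K by (subst ennreal_mult[symmetric]) auto
    also have "ennreal (1/2) * ennreal (measure M B / K) / emeasure M B
        \<le> (\<integral>\<^sup>+z\<in>B. ennreal \<bar>u z - m\<bar> \<partial>M) / emeasure M B"
      by (rule divide_right_mono_ennreal[OF osc])
    also note m
    also have "ennreal_powr ((\<integral>\<^sup>+z\<in>ball x0 R. ennreal_powr (g z) \<sigma> \<partial>M)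
                          / emeasure M (ball x0 R)) (1 / \<sigma>)
        \<le> ennreal ((C * real N * (4 / (real N * R)) powr \<sigma>) powr (1 / \<sigma>))"
    proof (rule ennreal_powr_le)
      let ?c = "C * real N * (4 / (real N * R)) powr \<sigma>"
      have "(\<integral>\<^sup>+z\<in>ball x0 R. ennreal_powr (g z) \<sigma> \<partial>M) / emeasure M (ball x0 R)
          \<le> ennreal ?c * emeasure M (ball x0 R) / emeasure M (ball x0 R)"
        unfolding g_def
        by (intro divide_right_mono_ennreal log_cutoff_energy_le[OF mm volume cutoff])
      also have "\<dots> = ennreal ?c"
        using ball_pos[of R x0] ball_finite[of R x0] r R
        by (intro ennreal_mult_divide_eq) auto
      finally show "(\<integral>\<^sup>+z\<in>ball x0 R. ennreal_powr (g z) \<sigma> \<partial>M) / emeasure M (ball x0 R) \<le> ennreal ?c" .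
    qed (use \<open>0 \<le> C\<close> \<sigma> in auto)
    also have "(C * real N * (4 / (real N * R)) powr \<sigma>) powr (1 / \<sigma>)
        = (C * real N) powr (1 / \<sigma>) * (4 / (real N * R))"
      using \<open>0 \<le> C\<close> \<sigma> r R by (simp add: powr_mult powr_powr)
    finally have "ennreal (1 / (2 * K))
        \<le> ennreal (P * (2 * r)) * ennreal ((C * real N) powr (1 / \<sigma>) * (4 / (real N * R)))"
      by (simp add: mult_left_mono)
    also have "\<dots> = ennreal (P * (2 * r) * ((C * real N) powr (1 / \<sigma>) * (4 / (real N * R))))"
      using P(1) r R by (intro ennreal_mult[symmetric]) auto
    also have "P * (2 * r) * ((C * real N) powr (1 / \<sigma>) * (4 / (real N * R)))
        = 4 * P / dil * (C * real N) powr (1 / \<sigma>) / real N"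
      using r dil N(1) by (simp add: R_def field_simps)
    finally have "1 / (2 * K) \<le> 4 * P / dil * (C * real N) powr (1 / \<sigma>) / real N"
      using P(1) dil by (subst (asm) ennreal_le_iff) auto
    with N(2) show False by simp
  qed
qed

lemma annular_chains_of_quasiconvex:
  fixes x0 :: "'a::metric_space"
  assumes "annularly_quasiconvex x0"
  shows "\<exists>\<Lambda>>1. \<forall>r>0. \<forall>\<epsilon>>0. \<forall>x \<in> sphere x0 r. \<forall>y \<in> sphere x0 r.
           chain_connected (ball x0 (\<Lambda> * r) - ball x0 (r / \<Lambda>)) \<epsilon> x y"
proof -
  obtain \<Lambda> where \<Lambda>: "2 \<le> \<Lambda>" and joined:
    "\<forall>r>0. \<forall>x \<in> ball x0 (2 * r) - ball x0 r. \<forall>y \<in> ball x0 (2 * r) - ball x0 r. x \<noteq> y \<longrightarrow>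
       (\<exists>\<gamma> l. arc_length_curve \<gamma> l \<and> \<gamma> 0 = x \<and> \<gamma> l = y \<and>
               \<gamma> ` {0..l} \<subseteq> ball x0 (\<Lambda> * r) - ball x0 (r / \<Lambda>) \<and> l \<le> \<Lambda> * dist x y)"
    using assms unfolding annularly_quasiconvex_def by (elim exE conjE)
  show ?thesis
  proof (intro exI[of _ \<Lambda>] conjI allI impI ballI)
    fix r \<epsilon> :: real and x y
    assume r: "0 < r" and \<epsilon>: "0 < \<epsilon>" and xy: "x \<in> sphere x0 r" "y \<in> sphere x0 r"
    let ?A = "ball x0 (\<Lambda> * r) - ball x0 (r / \<Lambda>)"
    show "chain_connected ?A \<epsilon> x y"
    proof (cases "x = y")
      case False
      then obtain \<gamma> l where \<gamma>: "arc_length_curve \<gamma> l" "\<gamma> 0 = x" "\<gamma> l = y" "\<gamma> ` {0..l} \<subseteq> ?A"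
        using joined[rule_format, of r x y] r xy by auto
      then have "connected (\<gamma> ` {0..l})" "0 \<in> {0..l}" "l \<in> {0..l}"
        by (auto simp: arc_length_curve_def intro: connected_continuous_image)
      with \<gamma> \<epsilon> show ?thesis
        by (intro connected_imp_chain_connected[of "\<gamma> ` {0..l}"]) auto
    qed simp
  qed (use \<Lambda> in simp)
qed

lemma frontier_ball_subset_sphere:
  "frontier (ball x r) \<subseteq> sphere x r"
proof -
  have "closure (ball x r) \<subseteq> cball x r" by (rule closure_minimal) auto
  then show ?thesis by (auto simp: frontier_def)
qed

theorem lemma5p4:
  fixes M :: "'a::metric_space measure" and p lam :: real and x0 :: 'a
  assumes "metric_measure_space M"
    and "\<not> bounded (UNIV :: 'a set)"
    and "1 < p"
    and "globally_doubling M"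
    and "supports_poincare M p lam"
    and "(\<exists>\<sigma>>1.
            (\<exists>C>0. \<forall>x r R. 0 < r \<and> r \<le> R \<longrightarrow>
               measure M (ball x r) / measure M (ball x R) \<le> C * (r / R) powr \<sigma>) \<and>
            (\<exists>lam'. supports_poincare M \<sigma> lam'))
         \<or> annularly_quasiconvex x0"
  shows "sequentially_annularly_chainable lam x0 \<and>
         (\<forall>r. radii_to_infinity r \<longrightarrow> annularly_chainable_along lam x0 r)"
proof -
  have lam: "1 \<le> lam" using assms(5) by (simp add: supports_poincare_def)
  have "\<exists>\<Lambda>>1. \<forall>r>0. \<forall>\<epsilon>>0. \<forall>x \<in> sphere x0 r. \<forall>y \<in> sphere x0 r.
           chain_connected (ball x0 (\<Lambda> * r) - ball x0 (r / \<Lambda>)) \<epsilon> x y"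
    using assms(6)
  proof (elim disjE exE conjE)
    fix \<sigma> C lam'
    assume \<sigma>: "1 < \<sigma>" "supports_poincare M \<sigma> lam'" and "\<forall>x r R. 0 < r \<and> r \<le> R \<longrightarrow>
               measure M (ball x r) / measure M (ball x R) \<le> C * (r / R) powr \<sigma>"
    then have "measure M (ball x s) / measure M (ball x t) \<le> C * (s / t) powr \<sigma>"
      if "0 < s" "s \<le> t" for x s t using that by blast
    with annular_chains_of_poincare[OF assms(1,4) \<sigma>(1) _ \<sigma>(2)] show ?thesis .
  next
    assume "annularly_quasiconvex x0"
    then show ?thesis by (rule annular_chains_of_quasiconvex)
  qed
  then obtain \<Lambda> where \<Lambda>: "1 < \<Lambda>" and chains:
    "\<forall>r>0. \<forall>\<epsilon>>0. \<forall>x \<in> sphere x0 r. \<forall>y \<in> sphere x0 r.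
       chain_connected (ball x0 (\<Lambda> * r) - ball x0 (r / \<Lambda>)) \<epsilon> x y"
    by (elim exE conjE)
  have all: "annularly_chainable_along lam x0 r" if "radii_to_infinity r" for r
    unfolding annularly_chainable_along_def
  proof (intro exI[of _ \<Lambda>] conjI allI ballI \<Lambda>)
    fix j x y assume xy: "x \<in> frontier (ball x0 (r j))" "y \<in> frontier (ball x0 (r j))"
    have r: "0 < r j" using that by (simp add: radii_to_infinity_def)
    have sphere: "x \<in> sphere x0 (r j)" "y \<in> sphere x0 (r j)"
      using xy frontier_ball_subset_sphere by blast+
    have "r j / \<Lambda> \<le> r j" "r j < \<Lambda> * r j" using r \<Lambda> by (auto simp: field_simps)
    then have "x \<in> ball x0 (\<Lambda> * r j) - ball x0 (r j / \<Lambda>)" using sphere(1) by auto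
    moreover have "0 < r j / (8 * lam * \<Lambda>)" using r lam \<Lambda> by simp
    from chains[rule_format, OF r this sphere]
    have "chain_connected (ball x0 (\<Lambda> * r j) - ball x0 (r j / \<Lambda>)) (r j / (8 * lam * \<Lambda>)) x y" .
    ultimately show "\<exists>xs. xs \<noteq> [] \<and> hd xs = x \<and> last xs = y \<and>
             set xs \<subseteq> ball x0 (\<Lambda> * r j) - ball x0 (r j / \<Lambda>) \<and>
             successively (\<lambda>a b. dist a b < r j / (8 * lam * \<Lambda>)) xs"
      by (intro chain_connected_imp_chain)
  qed
  have "radii_to_infinity (\<lambda>j. real (Suc j))"
    unfolding radii_to_infinity_def
    using filterlim_compose[OF filterlim_real_sequentially filterlim_Suc] by (simp add: incseq_def)
  with all show ?thesis unfolding sequentially_annularly_chainable_def by blast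
qed

end
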